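(* If $X$ is a (IV)-polyhedral normed space, then $S_X$ is covered by true faces of $B_X$, i.e. every point of $S_X$ belongs to some true face of $B_X$.
   Context: All normed spaces are real. For a normed space $X$, $B_X$ and $S_X$ denote its closed unit ball and unit sphere, and $X^*$ its topological dual. $\operatorname{ext} C$ is the set of extreme points of a convex set $C$. For $A\subseteq X^*$, $A'$ denotes the set of all $w^*$-cluster (accumulation) points of $A$, i.e. those $f$ each of whose $w^*$-neighbourhoods contains a point of $A$ different from $f$. (IV)-polyhedral: $f(x)<1$ for every $x\in S_X$ and $f\in(\operatorname{ext}B_{X^*})'$. A true face of $B_X$ is a set $B_X\cap H$, where $H=g^{-1}(1)$ with $g\in S_{X^*}$ is a hyperplane meeting $B_X$, whose interior relative to $H$ is non-empty. *)

theory Defs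
  imports "HOL-Analysis.Analysis"
begin

text \<open>
  The topological dual of a real normed space \<^typ>\<open>'a\<close> is \<^typ>\<open>'a \<Rightarrow>\<^sub>L real\<close> with
  its operator norm. For scalar-valued operators, the topology of pointwise convergence is
  the \<open>w\<^sup>*\<close>-topology.
\<close>

abbreviation weak_star_topology :: "('a::real_normed_vector \<Rightarrow>\<^sub>L real) topology"
  where "weak_star_topology \<equiv> strong_operator_topology"

definition ext :: "'a::real_vector set \<Rightarrow> 'a set"
  where "ext C = {x. x extreme_point_of C}"

text \<open>The argument \<^term>\<open>TYPE('a)\<close> names the normed space, all of \<^typ>\<open>'a\<close>.\<close>

definition IV_polyhedral :: "'a::real_normed_vector itself \<Rightarrow> bool"
  where "IV_polyhedral (_ :: 'a itself) \<longleftrightarrow>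
    (\<forall>x \<in> sphere (0::'a) 1.
      \<forall>f \<in> weak_star_topology derived_set_of (ext (cball (0 :: 'a \<Rightarrow>\<^sub>L real) 1)).
        blinfun_apply f x < 1)"

text \<open>
  The interior is taken in the hyperplane \<open>H\<close> itself; \<^const>\<open>rel_interior\<close> would take it
  in the affine hull of the face, which may be smaller than \<open>H\<close>.
\<close>

definition true_face_of_unit_ball :: "'a::real_normed_vector set \<Rightarrow> bool"
  where "true_face_of_unit_ball F \<longleftrightarrow>
    (\<exists>g \<in> sphere (0 :: 'a \<Rightarrow>\<^sub>L real) 1. \<exists>H.
      H = blinfun_apply g -` {1} \<and>
      cball 0 1 \<inter> H \<noteq> {} \<and>
      F = cball 0 1 \<inter> H \<and>
      top_of_set H interior_of F \<noteq> {})"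

end

theory Submission
  imports Defs
begin

text \<open>
  Fix a point \<open>x\<close> of the unit sphere. Every \<open>y\<close> is normed by some extreme point \<open>f\<close> of the dual
  ball, that is, \<open>f y = norm y\<close> (\<open>norming_extreme_point\<close>). Condition (IV) says that no functional
  with value 1 at \<open>x\<close> is a \<open>w\<^sup>*\<close>-cluster point of the extreme points; as the dual ball is
  \<open>w\<^sup>*\<close>-compact (\<open>compactin_dual_ball\<close>), only finitely many extreme points have values near 1 at
  \<open>x\<close>, and all of these have value exactly 1. Hence finitely many functionals \<open>f\<close> with \<open>f x = 1\<close>
  suffice to norm all points of a small ball around \<open>x\<close> (\<open>IV_polyhedral_locally_finite\<close>).

  This small ball is then a union of finitely many closed sets \<open>{y. f y = norm y}\<close>, so one of them
  has an interior point \<open>y\<close>. Near \<open>y\<close> the norm coincides with \<open>f\<close>, so the face of the unit ball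
  where \<open>f\<close> equals 1 contains a neighbourhood of \<open>y /\<^sub>R norm y\<close> in its hyperplane. It is a true face,
  and it contains \<open>x\<close>.

  The norming extreme points come from sublinear functionals rather than from
  the Hahn-Banach and Krein-Milman theorems separately. The \<open>w\<^sup>*\<close>-closed faces of the dual ball
  are represented by their support functions, and Zorn's lemma is applied to these; a minimal
  support function is linear, and is an extreme point.
\<close>

section \<open>Sublinear functionals and extreme linear minorants\<close>

definition sublinear :: "('a::real_vector \<Rightarrow> real) \<Rightarrow> bool"
  where "sublinear q \<longleftrightarrow>
    (\<forall>x y. q (x + y) \<le> q x + q y) \<and> (\<forall>c\<ge>0. \<forall>x. q (c *\<^sub>R x) = c * q x)"

lemma sublinearI:
  assumes add: "\<And>x y. q (x + y) \<le> q x + q y"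
    and scale: "\<And>c x. c > 0 \<Longrightarrow> q (c *\<^sub>R x) \<le> c * q x"
    and zero: "q 0 = 0"
  shows "sublinear q"
proof -
  have "q (c *\<^sub>R x) = c * q x" if "c \<ge> 0" for c x
  proof (cases "c = 0")
    case False
    with that have c: "c > 0" by simp
    then have "q x \<le> inverse c * q (c *\<^sub>R x)"
      using scale[of "inverse c" "c *\<^sub>R x"] by simp
    then have "c * q x \<le> q (c *\<^sub>R x)"
      using c by (simp add: field_simps)
    with scale[OF c, of x] show ?thesis by simp
  qed (simp add: zero)
  with add show ?thesis
    by (simp add: sublinear_def)
qed

lemma sublinear_add: "sublinear q \<Longrightarrow> q (x + y) \<le> q x + q y"
  and sublinear_scale: "sublinear q \<Longrightarrow> c \<ge> 0 \<Longrightarrow> q (c *\<^sub>R x) = c * q x"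
  by (simp_all add: sublinear_def)

lemma sublinear_zero: "sublinear q \<Longrightarrow> q 0 = 0"
  using sublinear_scale[of q 0 0] by simp

lemma sublinear_lower_bound: "sublinear q \<Longrightarrow> - q (- x) \<le> q x"
  using sublinear_add[of q x "- x"] sublinear_zero[of q] by simp

lemma sublinear_norm: "sublinear (norm :: 'a::real_normed_vector \<Rightarrow> real)"
  by (simp add: sublinear_def norm_triangle_ineq)

lemma sublinear_odd_imp_linear:
  assumes q: "sublinear q" and odd: "\<And>x. q (- x) = - q x"
  shows "linear q"
proof (rule linearI)
  show "q (x + y) = q x + q y" for x y
    using sublinear_add[OF q, of x y] sublinear_add[OF q, of "- x" "- y"] odd[of "x + y"]
    by (simp add: odd)
  show "q (c *\<^sub>R x) = c *\<^sub>R q x" for c x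
  proof (cases "c \<ge> 0")
    case False
    then have "q ((- c) *\<^sub>R x) = (- c) * q x"
      by (intro sublinear_scale[OF q]) simp
    then show ?thesis
      using odd[of "c *\<^sub>R x"] by simp
  qed (simp add: sublinear_scale[OF q])
qed

text \<open>
  The one-sided derivative of \<open>q\<close> at \<open>v\<close> in direction \<open>x\<close>, that is, the infimum over \<open>s > 0\<close> of the
  difference quotients \<open>(q (v + s x) - q v) / s\<close>: substitute \<open>s = 1 / t\<close>. It is the support
  function of the set of those linear minorants of \<open>q\<close> that agree with \<open>q\<close> at \<open>v\<close>.
\<close>

definition directional_derivative :: "('a::real_vector \<Rightarrow> real) \<Rightarrow> 'a \<Rightarrow> 'a \<Rightarrow> real"
  where "directional_derivative q v x = (INF t\<in>{0..}. q (x + t *\<^sub>R v) - t * q v)"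

lemma directional_derivative_bdd_below:
  assumes q: "sublinear q"
  shows "bdd_below ((\<lambda>t. q (x + t *\<^sub>R v) - t * q v) ` {0..})"
proof (rule bdd_belowI2[of _ "- q (- x)"])
  fix t :: real
  assume "t \<in> {0..}"
  then show "- q (- x) \<le> q (x + t *\<^sub>R v) - t * q v"
    using sublinear_add[OF q, of "x + t *\<^sub>R v" "- x"] sublinear_scale[OF q, of t v] by simp
qed

lemma directional_derivative_le:
  assumes "sublinear q" "t \<ge> 0"
  shows "directional_derivative q v x \<le> q (x + t *\<^sub>R v) - t * q v"
  unfolding directional_derivative_def
  using assms by (intro cINF_lower directional_derivative_bdd_below) auto

lemma directional_derivative_greatest:
  assumes "\<And>t. t \<ge> 0 \<Longrightarrow> m \<le> q (x + t *\<^sub>R v) - t * q v"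
  shows "m \<le> directional_derivative q v x"
  unfolding directional_derivative_def using assms by (intro cINF_greatest) auto

lemma directional_derivative_le_self:
  "sublinear q \<Longrightarrow> directional_derivative q v x \<le> q x"
  using directional_derivative_le[of q 0 v x] by simp

lemma directional_derivative_opposite:
  "sublinear q \<Longrightarrow> directional_derivative q v (- v) \<le> - q v"
  using directional_derivative_le[of q 1 v "- v"] sublinear_zero[of q] by simp

lemma sublinear_directional_derivative:
  assumes q: "sublinear q"
  shows "sublinear (directional_derivative q v)"
proof (rule sublinearI)
  let ?d = "directional_derivative q v"
  fix x y
  have "?d (x + y) - (q (y + t *\<^sub>R v) - t * q v) \<le> ?d x" if t: "t \<ge> 0" for t
  proof (rule directional_derivative_greatest)
    fix s :: real
    assume s: "s \<ge> 0"
    have "?d (x + y) \<le> q ((x + s *\<^sub>R v) + (y + t *\<^sub>R v)) - (s + t) * q v"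
      using directional_derivative_le[OF q, of "s + t" v "x + y"] s t
      by (simp add: algebra_simps)
    also have "\<dots> \<le> q (x + s *\<^sub>R v) + q (y + t *\<^sub>R v) - (s + t) * q v"
      using sublinear_add[OF q] by simp
    finally show "?d (x + y) - (q (y + t *\<^sub>R v) - t * q v) \<le> q (x + s *\<^sub>R v) - s * q v"
      by (simp add: algebra_simps)
  qed
  then have "?d (x + y) - ?d x \<le> ?d y"
    by (intro directional_derivative_greatest) (smt (verit))
  then show "?d (x + y) \<le> ?d x + ?d y" by simp
next
  let ?d = "directional_derivative q v"
  fix c :: real and x
  assume c: "c > 0"
  have "?d (c *\<^sub>R x) / c \<le> ?d x"
  proof (rule directional_derivative_greatest)
    fix t :: real
    assume t: "t \<ge> 0"
    have "?d (c *\<^sub>R x) \<le> q (c *\<^sub>R (x + t *\<^sub>R v)) - (c * t) * q v"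
      using directional_derivative_le[OF q, of "c * t" v "c *\<^sub>R x"] c t
      by (simp add: algebra_simps)
    also have "\<dots> = c * (q (x + t *\<^sub>R v) - t * q v)"
      using sublinear_scale[OF q, of c "x + t *\<^sub>R v"] c by (simp add: right_diff_distrib)
    finally show "?d (c *\<^sub>R x) / c \<le> q (x + t *\<^sub>R v) - t * q v"
      using c by (simp add: field_simps)
  qed
  then show "?d (c *\<^sub>R x) \<le> c * ?d x"
    using c by (simp add: field_simps)
next
  have "0 \<le> directional_derivative q v 0"
    by (rule directional_derivative_greatest) (simp add: sublinear_scale[OF q])
  then show "directional_derivative q v 0 = 0"
    using directional_derivative_le_self[OF q, of v 0] sublinear_zero[OF q] by simp
qed

text \<open>
  A sublinear \<open>q\<close> is the support function of the convex set of its linear minorants. The last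
  clause says that this set is a face of the set of linear minorants of \<open>p\<close>.
\<close>

definition face_support :: "('a::real_vector \<Rightarrow> real) \<Rightarrow> ('a \<Rightarrow> real) \<Rightarrow> bool"
  where "face_support p q \<longleftrightarrow> sublinear q \<and> q \<le> p \<and>
    (\<forall>f g u. linear f \<longrightarrow> linear g \<longrightarrow> f \<le> p \<longrightarrow> g \<le> p \<longrightarrow> 0 < u \<longrightarrow> u < 1 \<longrightarrow>
      (\<forall>x. (1 - u) * f x + u * g x \<le> q x) \<longrightarrow> f \<le> q \<and> g \<le> q)"

lemma face_supportI:
  assumes "sublinear q" "q \<le> p"
    "\<And>f g u. \<lbrakk>linear f; linear g; f \<le> p; g \<le> p; 0 < u; u < 1;
      \<And>x. (1 - u) * f x + u * g x \<le> q x\<rbrakk> \<Longrightarrow> f \<le> q \<and> g \<le> q"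
  shows "face_support p q"
  unfolding face_support_def
  by (intro conjI[OF assms(1)] conjI[OF assms(2)] allI impI, rule assms(3)) auto

lemma face_supportD:
  assumes "face_support p q" "linear f" "linear g" "f \<le> p" "g \<le> p" "0 < u" "u < 1"
    "\<And>x. (1 - u) * f x + u * g x \<le> q x"
  shows "f \<le> q" "g \<le> q"
  using assms unfolding face_support_def by simp_all

lemma face_support_self:
  assumes "sublinear p"
  shows "face_support p p"
  using assms by (simp add: face_support_def)

text \<open>
  The linear functionals that attain their maximum over a face at \<open>v\<close> form a smaller face: if a
  proper convex combination of two functionals in the face attains the maximum, then both do.
\<close>

lemma face_support_directional_derivative:
  assumes pq: "face_support p q"
  shows "face_support p (directional_derivative q v)"
proof -
  let ?d = "directional_derivative q v"
  have q: "sublinear q" and qp: "q \<le> p"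
    using pq by (auto simp: face_support_def)
  have dq: "?d x \<le> q x" for x
    by (rule directional_derivative_le_self[OF q])
  have minorant: "h \<le> ?d" if h: "linear h" "h \<le> q" "h v = q v" for h
  proof (rule le_funI, rule directional_derivative_greatest)
    fix x and t :: real
    have "h (x + t *\<^sub>R v) = h x + t * q v"
      using h by (simp add: linear_add linear_scale)
    then show "h x \<le> q (x + t *\<^sub>R v) - t * q v"
      using le_funD[OF h(2), of "x + t *\<^sub>R v"] by simp
  qed
  show ?thesis
  proof (rule face_supportI)
    show "sublinear ?d"
      by (rule sublinear_directional_derivative[OF q])
    show "?d \<le> p"
    proof (rule le_funI)
      show "?d x \<le> p x" for x
        using dq le_funD[OF qp] by (rule order_trans)
    qed
    fix f g and u :: real
    assume fg: "linear f" "linear g" "f \<le> p" "g \<le> p" and u: "0 < u" "u < 1"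
      and comb: "\<And>x. (1 - u) * f x + u * g x \<le> ?d x"
    have "(1 - u) * f x + u * g x \<le> q x" for x
      using comb dq by (rule order_trans)
    then have le: "f \<le> q" "g \<le> q"
      using face_supportD[OF pq fg u] by simp_all
    have "(1 - u) * f (- v) + u * g (- v) \<le> - q v"
      using comb directional_derivative_opposite[OF q] by (rule order_trans)
    then have "(1 - u) * (q v - f v) + u * (q v - g v) \<le> 0"
      using fg by (simp add: linear_neg algebra_simps)
    moreover have nonneg: "(1 - u) * (q v - f v) \<ge> 0" "u * (q v - g v) \<ge> 0"
      using u le by (auto simp: le_fun_def)
    ultimately have "(1 - u) * (q v - f v) + u * (q v - g v) = 0"
      by (intro antisym add_nonneg_nonneg)
    then have "(1 - u) * (q v - f v) = 0 \<and> u * (q v - g v) = 0"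
      by (simp only: add_nonneg_eq_0_iff[OF nonneg])
    then have "f v = q v" "g v = q v"
      using u by simp_all
    with le fg show "f \<le> ?d \<and> g \<le> ?d"
      using minorant by blast
  qed
qed

text \<open>
  The infimum of a chain is again subadditive because of any two members of the chain one is below
  the other, and intersections of faces are faces.
\<close>

lemma face_support_chain_Inf:
  assumes ne: "C \<noteq> {}" and face: "\<And>q. q \<in> C \<Longrightarrow> face_support p q"
    and chain: "\<And>q r. q \<in> C \<Longrightarrow> r \<in> C \<Longrightarrow> q \<le> r \<or> r \<le> q"
  shows "face_support p (\<lambda>x. INF q\<in>C. q x)"
    and "\<And>q. q \<in> C \<Longrightarrow> (\<lambda>x. INF q\<in>C. q x) \<le> q"
proof -
  let ?s = "\<lambda>x. INF q\<in>C. q x"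
  have sub: "sublinear q" if "q \<in> C" for q
    using face[OF that] by (simp add: face_support_def)
  have bdd: "bdd_below ((\<lambda>q. q x) ` C)" for x
  proof (rule bdd_belowI2[of _ "- p (- x)"])
    fix q
    assume q: "q \<in> C"
    then have "q (- x) \<le> p (- x)"
      using face by (simp add: face_support_def le_fun_def)
    then show "- p (- x) \<le> q x"
      using sublinear_lower_bound[OF sub[OF q], of x] by linarith
  qed
  have s_le: "?s x \<le> q x" if "q \<in> C" for q x
    using that bdd by (intro cINF_lower)
  have s_greatest: "m \<le> ?s x" if "\<And>q. q \<in> C \<Longrightarrow> m \<le> q x" for m x
    using that ne by (intro cINF_greatest)
  show below: "?s \<le> q" if "q \<in> C" for q
    using s_le[OF that] by (simp add: le_fun_def)
  have sub_s: "sublinear ?s"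
  proof (rule sublinearI)
    fix x y
    have pair: "?s (x + y) \<le> q x + r y" if qr: "q \<in> C" "r \<in> C" for q r
    proof -
      obtain m where m: "m \<in> C" "m \<le> q" "m \<le> r"
        using chain[OF qr] qr by blast
      have "?s (x + y) \<le> m x + m y"
        using s_le[OF m(1), of "x + y"] sublinear_add[OF sub[OF m(1)], of x y] by linarith
      also have "\<dots> \<le> q x + r y"
        using m by (intro add_mono) (auto simp: le_fun_def)
      finally show ?thesis .
    qed
    have "?s (x + y) - r y \<le> ?s x" if "r \<in> C" for r
      by (rule s_greatest) (use pair that in \<open>simp add: diff_le_eq\<close>)
    then have "?s (x + y) - ?s x \<le> ?s y"
      by (intro s_greatest) (simp add: algebra_simps)
    then show "?s (x + y) \<le> ?s x + ?s y" by simp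
  next
    fix c :: real and x
    assume c: "c > 0"
    have "?s (c *\<^sub>R x) / c \<le> ?s x"
    proof (rule s_greatest)
      fix q
      assume q: "q \<in> C"
      have "?s (c *\<^sub>R x) \<le> c * q x"
        using s_le[OF q, of "c *\<^sub>R x"] sublinear_scale[OF sub[OF q], of c x] c by simp
      then show "?s (c *\<^sub>R x) / c \<le> q x"
        using c by (simp add: field_simps)
    qed
    then show "?s (c *\<^sub>R x) \<le> c * ?s x"
      using c by (simp add: field_simps)
  next
    have "(\<lambda>q. q 0) ` C = {0}"
      using ne sub sublinear_zero by force
    then show "?s 0 = 0" by simp
  qed
  show "face_support p ?s"
  proof (rule face_supportI[OF sub_s])
    obtain q where "q \<in> C" using ne by blast
    then have "?s \<le> q" "q \<le> p"
      using below face by (auto simp: face_support_def)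
    then show "?s \<le> p" by (rule order_trans)
  next
    fix f g and u :: real
    assume fg: "linear f" "linear g" "f \<le> p" "g \<le> p" and u: "0 < u" "u < 1"
      and comb: "\<And>x. (1 - u) * f x + u * g x \<le> ?s x"
    have "f \<le> q \<and> g \<le> q" if q: "q \<in> C" for q
    proof -
      have "(1 - u) * f x + u * g x \<le> q x" for x
        using comb s_le[OF q] by (rule order_trans)
      then show ?thesis
        using face_supportD[OF face[OF q] fg u] by simp
    qed
    then show "f \<le> ?s \<and> g \<le> ?s"
      by (simp add: le_fun_def s_greatest)
  qed
qed

text \<open>
  Start with the face of those functionals that are maximal at \<open>x\<close> and shrink it to a minimal one,
  with support function \<open>q\<close>. Passing to a directional derivative cannot shrink it further, and
  this forces \<open>q (- v) = - q v\<close> for every \<open>v\<close>. So \<open>q\<close> is linear, and the face is a single point.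
\<close>

theorem exists_extreme_linear_minorant:
  fixes p :: "'a::real_vector \<Rightarrow> real"
  assumes p: "sublinear p"
  obtains f where "linear f" "f \<le> p" "f x = p x"
    "\<And>g h u. \<lbrakk>linear g; linear h; g \<le> p; h \<le> p; 0 < u; u < 1;
      \<And>y. f y = (1 - u) * g y + u * h y\<rbrakk> \<Longrightarrow> g = f \<and> h = f"
proof -
  \<comment> \<open>A linear \<open>f \<le> q\<close> has \<open>- f x \<le> q (- x)\<close>. So the second condition puts all members of
    the face into the set of functionals with value \<open>p x\<close> at \<open>x\<close>.\<close>
  let ?A = "{q. face_support p q \<and> q (- x) \<le> - p x}"
  let ?P = "\<lambda>a b. b \<le> (a :: 'a \<Rightarrow> real)"
  have "\<exists>m\<in>?A. \<forall>a\<in>?A. ?P m a \<longrightarrow> a = m"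
  proof (rule predicate_Zorn)
    show "partial_order_on ?A (relation_of ?P ?A)"
      by (rule partial_order_on_relation_ofI) auto
    fix C
    assume C: "C \<in> Chains (relation_of ?P ?A)"
    have sub: "C \<subseteq> ?A"
      using C by (rule Chains_relation_of)
    show "\<exists>u\<in>?A. \<forall>a\<in>C. ?P a u"
    proof (cases "C = {}")
      case True
      have "directional_derivative p x \<in> ?A"
        using face_support_directional_derivative[OF face_support_self[OF p], of x]
          directional_derivative_opposite[OF p, of x] by blast
      with True show ?thesis by blast
    next
      case False
      have face: "face_support p q" if "q \<in> C" for q
        using that sub by blast
      have chain: "q \<le> r \<or> r \<le> q" if "q \<in> C" "r \<in> C" for q r
        using C that by (auto simp: Chains_def relation_of_def)
      have inf_face: "face_support p (\<lambda>x. INF q\<in>C. q x)"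
        by (rule face_support_chain_Inf(1)[OF False]) (use face chain in blast)+
      have inf_le: "(\<lambda>x. INF q\<in>C. q x) \<le> q" if "q \<in> C" for q
        by (rule face_support_chain_Inf(2)[OF False _ _ that]) (use face chain in blast)+
      obtain q where q: "q \<in> C" using False by blast
      have "(INF q\<in>C. q (- x)) \<le> q (- x)"
        using le_funD[OF inf_le[OF q], of "- x"] .
      also have "\<dots> \<le> - p x" using q sub by blast
      finally show ?thesis
        using inf_face inf_le by (intro bexI[of _ "\<lambda>x. INF q\<in>C. q x"]) auto
    qed
  qed
  then obtain f where fA: "f \<in> ?A" and min: "\<And>a. a \<in> ?A \<Longrightarrow> a \<le> f \<Longrightarrow> a = f"
    by blast
  have face: "face_support p f" and fx: "f (- x) \<le> - p x"
    using fA by auto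
  have sub: "sublinear f" and le: "f \<le> p"
    using face by (auto simp: face_support_def)
  have "f (- v) = - f v" for v
  proof -
    have d_le: "directional_derivative f v \<le> f"
      using directional_derivative_le_self[OF sub] by (simp add: le_fun_def)
    then have "directional_derivative f v (- x) \<le> - p x"
      using le_funD[OF d_le, of "- x"] fx by linarith
    then have "directional_derivative f v = f"
      using face_support_directional_derivative[OF face, of v] d_le by (intro min) auto
    then have "f (- v) \<le> - f v"
      using directional_derivative_opposite[OF sub, of v] by simp
    then show ?thesis
      using sublinear_lower_bound[OF sub, of v] by simp
  qed
  then have lin: "linear f"
    using sub by (rule sublinear_odd_imp_linear[rotated])
  have below_imp_eq: "g = f" if g: "linear g" "g \<le> f" for g
  proof
    fix y
    show "g y = f y"
      using le_funD[OF g(2), of y] le_funD[OF g(2), of "- y"] g lin by (simp add: linear_neg)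
  qed
  show ?thesis
  proof (rule that[OF lin le])
    show "f x = p x"
      using fx lin le_funD[OF le, of x] by (simp add: linear_neg)
    fix g h :: "'a \<Rightarrow> real" and u :: real
    assume gh: "linear g" "linear h" "g \<le> p" "h \<le> p" "0 < u" "u < 1"
      and eq: "\<And>y. f y = (1 - u) * g y + u * h y"
    have "(1 - u) * g y + u * h y \<le> f y" for y
      by (simp add: eq)
    then have "g \<le> f \<and> h \<le> f"
      using face_supportD[OF face gh] by simp
    with gh show "g = f \<and> h = f"
      using below_imp_eq by blast
  qed
qed

section \<open>The dual unit ball\<close>

lemma dual_ball_iff:
  "f \<in> cball (0 :: 'a::real_normed_vector \<Rightarrow>\<^sub>L real) 1 \<longleftrightarrow> (\<forall>x. blinfun_apply f x \<le> norm x)"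
proof
  assume "f \<in> cball 0 1"
  then have "norm f \<le> 1" by simp
  show "\<forall>x. blinfun_apply f x \<le> norm x"
  proof
    fix x
    have "\<bar>blinfun_apply f x\<bar> \<le> norm f * norm x"
      using norm_blinfun[of f x] by simp
    also have "\<dots> \<le> norm x"
      using \<open>norm f \<le> 1\<close> mult_right_mono[of "norm f" 1 "norm x"] by simp
    finally show "blinfun_apply f x \<le> norm x" by simp
  qed
next
  assume le: "\<forall>x. blinfun_apply f x \<le> norm x"
  have "norm (blinfun_apply f x) \<le> 1 * norm x" for x
    using le[rule_format, of x] le[rule_format, of "- x"] by (simp add: blinfun.minus_right)
  then have "norm f \<le> 1"
    by (intro norm_blinfun_bound) auto
  then show "f \<in> cball 0 1" by simp
qed

lemma dual_ball_of_linear: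
  fixes h :: "'a::real_normed_vector \<Rightarrow> real"
  assumes "linear h" "\<And>x. h x \<le> norm x"
  obtains f where "f \<in> cball (0 :: 'a \<Rightarrow>\<^sub>L real) 1" "blinfun_apply f = h"
proof -
  have "norm (h x) \<le> norm x * 1" for x
    using assms(2)[of x] assms(2)[of "- x"] assms(1) by (simp add: linear_neg)
  then have "bounded_linear h"
    using assms(1) by (intro bounded_linear_intro[of h 1]) (auto simp: linear_add linear_scale)
  then have eq: "blinfun_apply (Blinfun h) = h"
    by (rule bounded_linear_Blinfun_apply)
  with assms(2) have "Blinfun h \<in> cball 0 1"
    by (subst dual_ball_iff) simp
  with eq show ?thesis using that by blast
qed

lemma norming_extreme_point:
  fixes x :: "'a::real_normed_vector"
  obtains f where "f \<in> ext (cball (0 :: 'a \<Rightarrow>\<^sub>L real) 1)" "blinfun_apply f x = norm x"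
proof -
  obtain h :: "'a \<Rightarrow> real" where h: "linear h" "h \<le> norm" "h x = norm x"
    and extreme: "\<And>g k u. \<lbrakk>linear g; linear k; g \<le> norm; k \<le> norm; 0 < u; u < 1;
      \<And>y. h y = (1 - u) * g y + u * k y\<rbrakk> \<Longrightarrow> g = h \<and> k = h"
    using exists_extreme_linear_minorant[OF sublinear_norm] by blast
  obtain f where f: "f \<in> cball (0 :: 'a \<Rightarrow>\<^sub>L real) 1" "blinfun_apply f = h"
    using dual_ball_of_linear[OF h(1)] h(2) by (auto simp: le_fun_def)
  have "f \<notin> open_segment a b"
    if ab: "a \<in> cball (0 :: 'a \<Rightarrow>\<^sub>L real) 1" "b \<in> cball (0 :: 'a \<Rightarrow>\<^sub>L real) 1" for a b
  proof
    assume "f \<in> open_segment a b"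
    then obtain u where u: "a \<noteq> b" "0 < u" "u < 1" "f = (1 - u) *\<^sub>R a + u *\<^sub>R b"
      by (auto simp: in_segment)
    have lin: "linear (blinfun_apply a)" "linear (blinfun_apply b)"
      by (simp_all add: bounded_linear.linear blinfun.bounded_linear_right)
    have le: "blinfun_apply a \<le> norm" "blinfun_apply b \<le> norm"
      using ab by (auto simp only: dual_ball_iff le_fun_def)
    have "h y = (1 - u) * blinfun_apply a y + u * blinfun_apply b y" for y
      unfolding f(2)[symmetric] u(4) by (simp add: blinfun.add_left blinfun.scaleR_left)
    then have "blinfun_apply a = h \<and> blinfun_apply b = h"
      using extreme lin le u by blast
    then have "a = b"
      by (simp add: blinfun_apply_inject[symmetric])
    with u show False by blast
  qed
  then have "f \<in> ext (cball 0 1)"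
    using f by (simp add: ext_def extreme_point_of_def)
  then show ?thesis
    using that f h by blast
qed

text \<open>
  Banach-Alaoglu: as a set of functions, the dual ball is the closed subset of the linear functions
  in a product of compact intervals.
\<close>

lemma compactin_dual_ball:
  "compactin weak_star_topology (cball (0 :: 'a::real_normed_vector \<Rightarrow>\<^sub>L real) 1)"
proof -
  define P :: "('a \<Rightarrow> real) set" where "P = (\<Pi>\<^sub>E x\<in>UNIV. cball 0 (norm x))"
  define L :: "('a \<Rightarrow> real) set" where
    "L = {h. (\<forall>x y. h (x + y) = h x + h y) \<and> (\<forall>c x. h (c *\<^sub>R x) = c * h x)}"
  have "compact P"
    unfolding P_def compactin_euclidean_iff[symmetric] euclidean_product_topology[symmetric]
    by (simp add: compactin_PiE)
  moreover have "closed L"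
    unfolding L_def
    by (intro closed_Collect_conj closed_Collect_all closed_Collect_eq
        continuous_on_add continuous_on_mult continuous_on_const continuous_on_product_coordinates)
  ultimately have compact: "compact (P \<inter> L)"
    by (rule compact_Int_closed)
  have image: "blinfun_apply ` cball (0 :: 'a \<Rightarrow>\<^sub>L real) 1 = P \<inter> L"
  proof
    show "blinfun_apply ` cball (0 :: 'a \<Rightarrow>\<^sub>L real) 1 \<subseteq> P \<inter> L"
    proof (rule image_subsetI)
      fix f :: "'a \<Rightarrow>\<^sub>L real"
      assume f: "f \<in> cball 0 1"
      then have le: "blinfun_apply f x \<le> norm x" for x
        by (simp only: dual_ball_iff)
      have "\<bar>blinfun_apply f x\<bar> \<le> norm x" for x
        using le[of x] le[of "- x"] by (simp add: blinfun.minus_right)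
      then show "blinfun_apply f \<in> P \<inter> L"
        by (simp add: P_def PiE_UNIV_domain L_def blinfun.add_right blinfun.scaleR_right)
    qed
    show "P \<inter> L \<subseteq> blinfun_apply ` cball (0 :: 'a \<Rightarrow>\<^sub>L real) 1"
    proof
      fix h
      assume h: "h \<in> P \<inter> L"
      then have "linear h"
        by (intro linearI) (auto simp: L_def)
      moreover have "h x \<le> norm x" for x
        using h by (auto simp: P_def PiE_iff abs_le_iff)
      ultimately show "h \<in> blinfun_apply ` cball 0 1"
        using dual_ball_of_linear[of h] by (metis image_eqI)
    qed
  qed
  show ?thesis
    unfolding compactin_def
  proof (intro conjI allI impI)
    show "cball (0 :: 'a \<Rightarrow>\<^sub>L real) 1 \<subseteq> topspace weak_star_topology"
      by (simp add: strong_operator_topology_topspace)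
    fix \<U> :: "('a \<Rightarrow>\<^sub>L real) set set"
    assume "Ball \<U> (openin weak_star_topology) \<and> cball 0 1 \<subseteq> \<Union> \<U>"
    then have op: "\<And>U. U \<in> \<U> \<Longrightarrow> openin weak_star_topology U" and cov: "cball 0 1 \<subseteq> \<Union> \<U>"
      by auto
    have "\<exists>V. open V \<and> U = blinfun_apply -` V" if "U \<in> \<U>" for U
      using op[OF that] unfolding strong_operator_topology_def openin_pullback_topology by auto
    then obtain V where V: "\<And>U. U \<in> \<U> \<Longrightarrow> open (V U) \<and> U = blinfun_apply -` V U"
      by metis
    have "P \<inter> L \<subseteq> (\<Union>U\<in>\<U>. V U)"
    proof
      fix h
      assume "h \<in> P \<inter> L"
      then obtain f where f: "f \<in> cball 0 1" "h = blinfun_apply f"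
        unfolding image[symmetric] by blast
      then obtain U where "U \<in> \<U>" "f \<in> U"
        using cov by blast
      then show "h \<in> (\<Union>U\<in>\<U>. V U)"
        using V f by blast
    qed
    then obtain \<F> where F: "\<F> \<subseteq> \<U>" "finite \<F>" "P \<inter> L \<subseteq> (\<Union>U\<in>\<F>. V U)"
      using compactE_image[OF compact, of \<U> V] V by metis
    have "cball 0 1 \<subseteq> \<Union> \<F>"
    proof
      fix f :: "'a \<Rightarrow>\<^sub>L real"
      assume "f \<in> cball 0 1"
      then have "blinfun_apply f \<in> P \<inter> L"
        unfolding image[symmetric] by blast
      then obtain U where "U \<in> \<F>" "blinfun_apply f \<in> V U"
        using F by blast
      then show "f \<in> \<Union> \<F>"
        using V F by blast
    qed
    with F show "\<exists>\<F>. finite \<F> \<and> \<F> \<subseteq> \<U> \<and> cball 0 1 \<subseteq> \<Union> \<F>"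
      by blast
  qed
qed

section \<open>Local structure of the unit ball\<close>

text \<open>
  Each \<open>f\<close> in the dual ball gets a neighbourhood \<open>N f\<close>: if \<open>f x = 1\<close>, then (IV) allows one that
  contains no extreme points except possibly \<open>f\<close>; if \<open>f x < 1\<close>, take one on which the values at
  \<open>x\<close> stay away from 1. By compactness finitely many neighbourhoods cover the dual ball. An extreme
  point that norms some \<open>y\<close> close to \<open>x\<close> has a value close to 1 at \<open>x\<close>, so it lies in one of the
  neighbourhoods of the first kind, and thus is its centre.
\<close>

lemma IV_polyhedral_locally_finite:
  fixes x :: "'a::real_normed_vector"
  assumes IV: "IV_polyhedral TYPE('a)" and x: "norm x = 1"
  obtains T r where "finite T" "r > 0"
    "\<And>f. f \<in> T \<Longrightarrow> f \<in> cball (0 :: 'a \<Rightarrow>\<^sub>L real) 1 \<and> blinfun_apply f x = 1"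
    "\<And>y. dist x y < r \<Longrightarrow> \<exists>f\<in>T. blinfun_apply f y = norm y"
proof -
  let ?B = "cball (0 :: 'a \<Rightarrow>\<^sub>L real) 1"
  have "\<exists>N. openin weak_star_topology N \<and> f \<in> N \<and>
      (if blinfun_apply f x = 1 then N \<inter> ext ?B \<subseteq> {f}
       else N = {g. blinfun_apply g x < (1 + blinfun_apply f x) / 2})"
    if f: "f \<in> ?B" for f
  proof (cases "blinfun_apply f x = 1")
    case True
    then have "f \<notin> weak_star_topology derived_set_of (ext ?B)"
      using IV x unfolding IV_polyhedral_def
      by (metis less_irrefl mem_sphere_0)
    then obtain N where "f \<in> N" "openin weak_star_topology N" "\<forall>y\<in>ext ?B. y \<in> N \<longrightarrow> y = f"
      by (auto simp: in_derived_set_of strong_operator_topology_topspace)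
    with True show ?thesis by auto
  next
    case False
    let ?c = "(1 + blinfun_apply f x) / 2"
    have "blinfun_apply f x \<le> 1"
      using f x unfolding dual_ball_iff by metis
    with False have "blinfun_apply f x < ?c" by simp
    moreover have "openin weak_star_topology {g :: 'a \<Rightarrow>\<^sub>L real. blinfun_apply g x < ?c}"
      using strong_operator_topology_basis[of "{()}" "\<lambda>_. {..<?c}" "\<lambda>_. x"] by simp
    ultimately show ?thesis using False by auto
  qed
  then obtain N where N_open: "\<And>f. f \<in> ?B \<Longrightarrow> openin weak_star_topology (N f)"
    and N_self: "\<And>f. f \<in> ?B \<Longrightarrow> f \<in> N f"
    and N: "\<And>f. f \<in> ?B \<Longrightarrow> if blinfun_apply f x = 1 then N f \<inter> ext ?B \<subseteq> {f}
       else N f = {g. blinfun_apply g x < (1 + blinfun_apply f x) / 2}"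
    by metis
  obtain \<F> where "finite \<F>" "\<F> \<subseteq> N ` ?B" and cov: "?B \<subseteq> \<Union> \<F>"
    using compactinD[OF compactin_dual_ball, of "N ` ?B"] N_open N_self by blast
  then obtain S where S: "S \<subseteq> ?B" "finite S" "\<F> = N ` S"
    using finite_subset_image by metis
  let ?D = "(\<lambda>f. (1 - blinfun_apply f x) / 2) ` {f \<in> S. blinfun_apply f x \<noteq> 1}"
  define \<delta> where "\<delta> = Min (insert 1 ?D)"
  have fin: "finite (insert 1 ?D)"
    using S by simp
  have le1: "blinfun_apply f x \<le> 1" if "f \<in> ?B" for f
    using that x unfolding dual_ball_iff by metis
  have "\<delta> > 0"
  proof -
    have "blinfun_apply f x < 1" if "f \<in> S" "blinfun_apply f x \<noteq> 1" for f
      using le1[of f] that S by force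
    then show ?thesis
      unfolding \<delta>_def using fin by (subst Min_gr_iff) auto
  qed
  show ?thesis
  proof (rule that[of "{f \<in> S. blinfun_apply f x = 1}" "\<delta> / 2"])
    show "finite {f \<in> S. blinfun_apply f x = 1}" "\<delta> / 2 > 0"
      using S \<open>\<delta> > 0\<close> by auto
    show "f \<in> ?B \<and> blinfun_apply f x = 1" if "f \<in> {f \<in> S. blinfun_apply f x = 1}" for f
      using that S by blast
    fix y
    assume y: "dist x y < \<delta> / 2"
    obtain e where e: "e \<in> ext ?B" "blinfun_apply e y = norm y"
      by (rule norming_extreme_point)
    have eB: "e \<in> ?B"
      using e by (simp add: ext_def extreme_point_of_def)
    then obtain f where f: "f \<in> S" "e \<in> N f"
      using cov S by blast
    have ex: "blinfun_apply e x > 1 - \<delta>"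
    proof -
      have "blinfun_apply e (y - x) \<le> norm (y - x)"
        using eB unfolding dual_ball_iff by blast
      moreover have "norm x \<le> norm y + norm (y - x)"
        using norm_triangle_sub[of x y] by (simp add: norm_minus_commute)
      ultimately show ?thesis
        using y x e by (simp add: blinfun.diff_right dist_norm norm_minus_commute)
    qed
    have "blinfun_apply f x = 1"
    proof (rule ccontr)
      assume ne: "blinfun_apply f x \<noteq> 1"
      then have "blinfun_apply e x < (1 + blinfun_apply f x) / 2"
        using N[of f] f S by auto
      moreover have "\<delta> \<le> (1 - blinfun_apply f x) / 2"
        unfolding \<delta>_def using fin f ne by (intro Min_le) auto
      ultimately show False
        using ex by (simp add: field_simps)
    qed
    moreover from this have "N f \<inter> ext ?B \<subseteq> {f}"
      using N[of f] f S by (metis subsetD)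
    then have "e = f"
      using f e by blast
    ultimately show "\<exists>f\<in>{f \<in> S. blinfun_apply f x = 1}. blinfun_apply f y = norm y"
      using f e by blast
  qed
qed

lemma interior_finite_UN_closed:
  assumes "finite T" "\<And>i. i \<in> T \<Longrightarrow> closed (A i)" "interior (\<Union>i\<in>T. A i) \<noteq> {}"
  shows "\<exists>i\<in>T. interior (A i) \<noteq> {}"
  using assms
proof (induction T)
  case (insert i T)
  show ?case
  proof (cases "interior (\<Union>j\<in>T. A j) = {}")
    case True
    then have "interior (A i \<union> (\<Union>j\<in>T. A j)) = interior (A i)"
      using insert.prems by (intro interior_closed_Un_empty_interior) auto
    with insert.prems show ?thesis by auto
  next
    case False
    with insert show ?thesis by auto
  qed
qed simp

text \<open>
  Rescaling by \<open>norm y\<close> moves the points of the hyperplane near \<open>y /\<^sub>R norm y\<close> into \<open>W\<close>, where their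
  norm can be read off from \<open>f\<close>.
\<close>

lemma true_face_if_norm_eq_on_open:
  fixes x y :: "'a::real_normed_vector"
  assumes f: "f \<in> cball (0 :: 'a \<Rightarrow>\<^sub>L real) 1" and x: "norm x = 1" "blinfun_apply f x = 1"
    and W: "open W" "y \<in> W" "y \<noteq> 0" "\<And>w. w \<in> W \<Longrightarrow> blinfun_apply f w = norm w"
  shows "true_face_of_unit_ball (cball 0 1 \<inter> blinfun_apply f -` {1})"
proof -
  let ?H = "blinfun_apply f -` {1}"
  let ?V = "(\<lambda>w. norm y *\<^sub>R w) -` W"
  have "norm f \<ge> 1"
    using norm_blinfun[of f x] x by simp
  with f have "f \<in> sphere 0 1" by simp
  moreover have "x \<in> cball 0 1 \<inter> ?H"
    using x by simp
  moreover have "inverse (norm y) *\<^sub>R y \<in> top_of_set ?H interior_of (cball 0 1 \<inter> ?H)"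
    unfolding interior_of_def
  proof (clarify, intro exI conjI)
    have "open ?V"
      using W(1) by (intro open_vimage continuous_intros)
    then show "openin (top_of_set ?H) (?H \<inter> ?V)"
      by (rule openin_open_Int)
    show "inverse (norm y) *\<^sub>R y \<in> ?H \<inter> ?V"
      using W by (simp add: blinfun.scaleR_right)
    show "?H \<inter> ?V \<subseteq> cball 0 1 \<inter> ?H"
    proof
      fix w
      assume w: "w \<in> ?H \<inter> ?V"
      then have "norm y * norm w = norm y"
        using W(4)[of "norm y *\<^sub>R w"] by (simp add: blinfun.scaleR_right)
      with W(3) w show "w \<in> cball 0 1 \<inter> ?H" by simp
    qed
  qed
  ultimately show ?thesis
    unfolding true_face_of_unit_ball_def by blast
qed

theorem corollary3p3:
  assumes "IV_polyhedral TYPE('a::real_normed_vector)"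
  shows "\<forall>x \<in> sphere (0::'a) 1. \<exists>F. true_face_of_unit_ball F \<and> x \<in> F"
proof
  fix x :: 'a
  assume "x \<in> sphere 0 1"
  then have x: "norm x = 1" by simp
  obtain T r where T: "finite T" "r > 0"
    "\<And>f. f \<in> T \<Longrightarrow> f \<in> cball (0 :: 'a \<Rightarrow>\<^sub>L real) 1 \<and> blinfun_apply f x = 1"
    "\<And>y. dist x y < r \<Longrightarrow> \<exists>f\<in>T. blinfun_apply f y = norm y"
    using IV_polyhedral_locally_finite[OF assms x] by blast
  \<comment> \<open>Besides keeping the ball inside the region normed by \<open>T\<close>, the radius excludes the origin.\<close>
  define s where "s = min (r / 2) (1 / 2)"
  let ?A = "\<lambda>f. cball x s \<inter> {y. blinfun_apply f y = norm y}"
  have s: "0 < s" "s < r" "s < 1"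
    using T(2) by (auto simp: s_def)
  have "cball x s \<subseteq> (\<Union>f\<in>T. ?A f)"
    using T(4) s by fastforce
  then have "ball x s \<subseteq> interior (\<Union>f\<in>T. ?A f)"
    using ball_subset_cball by (intro interior_maximal) blast+
  then have "interior (\<Union>f\<in>T. ?A f) \<noteq> {}"
    using s(1) by (metis centre_in_ball empty_iff subsetD)
  moreover have "closed (?A f)" for f
    by (intro closed_Int closed_cball closed_Collect_eq continuous_intros)
  ultimately obtain f where f: "f \<in> T" "interior (?A f) \<noteq> {}"
    using interior_finite_UN_closed[OF T(1), of ?A] by blast
  then obtain y where y: "y \<in> interior (?A f)" by blast
  have eq: "blinfun_apply f w = norm w" if "w \<in> interior (?A f)" for w
    using that interior_subset[of "?A f"] by blast
  have "y \<in> cball x s"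
    using y interior_subset[of "?A f"] by blast
  then have "y \<noteq> 0"
    using x s by auto
  with y eq have "true_face_of_unit_ball (cball 0 1 \<inter> blinfun_apply f -` {1})"
    using T(3)[OF f(1)] x by (intro true_face_if_norm_eq_on_open[of f x "interior (?A f)" y]) auto
  moreover have "x \<in> cball 0 1 \<inter> blinfun_apply f -` {1}"
    using T(3)[OF f(1)] x by simp
  ultimately show "\<exists>F. true_face_of_unit_ball F \<and> x \<in> F"
    by blast
qed

end
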